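(* Let $q\ge 0$, $n\ge q$ and $m\ge 1$ be integers, let $0\le\epsilon\le 1$, and let $\tilde\lambda(x)=\sum_{l=0}^{q}\tilde\lambda_l x^l$ be a probability distribution on $\{0,\dots,q\}$ (the original degree distribution). For receiver degrees $r,\hat r\in\{0,\dots,q\}$ and transmitter degree $l\in\{0,\dots,q\}$, let $\tilde p_l^{(r)}$ be the probability that a user of original degree $l$ is not resolved by a receiver of degree $r$ in the all-to-all broadcast coded slotted ALOHA system with parameters $(n,m,\epsilon,\tilde\lambda)$. If $\hat r>r$, then $$\tilde p_l^{(\hat r)}\ \ge\ \tilde p_l^{(r)} .$$
   Context: All-to-all broadcast coded slotted ALOHA with parameters $(n,m,\epsilon,\tilde\lambda)$. A frame has $n$ slots. There is a receiver $\mathsf A$ and a set of $m$ other users (neighbors). Transmission: each neighbor independently draws a degree $l$ with probability $\tilde\lambda_l$ and then transmits copies of its packet in a uniformly random set of $l$ distinct slots out of the $n$ slots. Each copy is independently erased with probability $\epsilon$; an erased copy is treated as absent (it is not received and causes no interference). The receiver $\mathsf A$ of degree $r$ itself transmits in a uniformly random set of $r$ distinct slots, independent of everything else, and because of half-duplex operation it receives nothing in those $r$ slots. Graph seen by the receiver: the bipartite graph whose variable nodes (VNs) are the $m$ neighbors and whose check nodes (CNs) are the $n-r$ slots not used by $\mathsf A$; there is an edge between a user and a slot if the user sent a non-erased copy in that slot. Decoding (successive interference cancellation): repeatedly, if some slot (CN) currently has degree exactly one, the unique user adjacent to it is declared resolved, and that user together with all its edges is removed from the graph; stop when no slot has degree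 one. Users never resolved are called unresolved (in particular a user with no edges is unresolved). $\tilde p_l^{(r)}$ is the probability that a given neighbor is unresolved, given that its original degree is $l$ (its $l$ slots being uniformly random, and the other $m-1$ neighbors drawing their degrees from $\tilde\lambda$) and that the receiver has degree $r$. *)

theory Defs
  imports "HOL-Probability.Probability"
begin

text \<open>A bipartite graph is given by its check nodes \<open>C\<close> (slots), its variable nodes \<open>V\<close> (users) and
  a map \<open>E\<close> sending each user to a set of slots: \<open>v \<in> V\<close> and \<open>s \<in> C\<close> are adjacent iff \<open>s \<in> E v\<close>.
  Values in \<open>E v\<close> outside \<open>C\<close> are not edges. Removing a user together with its edges amounts to
  removing it from \<open>V\<close>, so a state of the decoder is the set of users still present.\<close>

definition slot_nbrs :: "('v \<Rightarrow> 's set) \<Rightarrow> 'v set \<Rightarrow> 's \<Rightarrow> 'v set" where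
  "slot_nbrs E V s = {v \<in> V. s \<in> E v}"

inductive sic_step :: "'s set \<Rightarrow> ('v \<Rightarrow> 's set) \<Rightarrow> 'v set \<Rightarrow> 'v set \<Rightarrow> bool"
  for C :: "'s set" and E :: "'v \<Rightarrow> 's set" where
  "s \<in> C \<Longrightarrow> slot_nbrs E V s = {v} \<Longrightarrow> sic_step C E V (V - {v})"

definition sic_stopped :: "'s set \<Rightarrow> ('v \<Rightarrow> 's set) \<Rightarrow> 'v set \<Rightarrow> bool" where
  "sic_stopped C E V \<longleftrightarrow> (\<forall>s\<in>C. card (slot_nbrs E V s) \<noteq> 1)"

definition unresolved :: "'s set \<Rightarrow> ('v \<Rightarrow> 's set) \<Rightarrow> 'v set \<Rightarrow> 'v set" where
  "unresolved C E V = (THE W. (sic_step C E)\<^sup>*\<^sup>* V W \<and> sic_stopped C E W)"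

text \<open>The description above is legitimate: the outcome of decoding does not depend on the order in
  which degree-one slots are processed.\<close>

lemma sic_stopped_subset:
  assumes "(sic_step C E)\<^sup>*\<^sup>* V W" and "sic_stopped C E W'" and "W' \<subseteq> V"
  shows "W' \<subseteq> W"
  using assms(1)
proof (induction rule: rtranclp_induct)
  case base
  show ?case by (fact assms(3))
next
  case (step X Y)
  from step.hyps(2) obtain s v where s: "s \<in> C" "slot_nbrs E X s = {v}" "Y = X - {v}"
    by (auto elim: sic_step.cases)
  have "v \<notin> W'"
  proof
    assume "v \<in> W'"
    with s step.IH have "slot_nbrs E W' s = {v}"
      by (auto simp: slot_nbrs_def)
    with s(1) assms(2) show False
      by (auto simp: sic_stopped_def)
  qed
  with s step.IH show ?case by auto
qed

lemma sic_step_subset: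
  assumes "(sic_step C E)\<^sup>*\<^sup>* V W"
  shows "W \<subseteq> V"
  using assms by (induction rule: rtranclp_induct) (auto elim: sic_step.cases)

lemma sic_terminates:
  assumes "finite V"
  shows "\<exists>W. (sic_step C E)\<^sup>*\<^sup>* V W \<and> sic_stopped C E W"
  using assms
proof (induction V rule: finite_psubset_induct)
  case (psubset V)
  show ?case
  proof (cases "sic_stopped C E V")
    case True
    then show ?thesis by blast
  next
    case False
    then obtain s v where s: "s \<in> C" "slot_nbrs E V s = {v}"
      by (auto simp: sic_stopped_def card_1_singleton_iff)
    then have "v \<in> V" by (auto simp: slot_nbrs_def)
    then have "V - {v} \<subset> V" by blast
    from psubset.IH[OF this] sic_step.intros[of s C E V v, OF s]
    show ?thesis by (meson converse_rtranclp_into_rtranclp)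
  qed
qed

lemma sic_unique_outcome:
  assumes "finite V"
  shows "\<exists>!W. (sic_step C E)\<^sup>*\<^sup>* V W \<and> sic_stopped C E W"
  using sic_terminates[OF assms, of C E]
  by (metis sic_step_subset sic_stopped_subset subset_antisym)

definition slots_pmf :: "nat \<Rightarrow> nat \<Rightarrow> nat set pmf" where
  "slots_pmf n d = pmf_of_set {S. S \<subseteq> {..<n} \<and> card S = d}"

text \<open>The copies that survive when those sent in the slots \<open>S\<close> are independently erased with
  probability \<open>\<epsilon>\<close> each.\<close>

definition erasure_pmf :: "real \<Rightarrow> nat set \<Rightarrow> nat set pmf" where
  "erasure_pmf \<epsilon> S =
     map_pmf (\<lambda>kept. {s \<in> S. kept s}) (Pi_pmf S False (\<lambda>_. bernoulli_pmf (1 - \<epsilon>)))"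

definition user_pmf :: "nat \<Rightarrow> real \<Rightarrow> nat pmf \<Rightarrow> nat set pmf" where
  "user_pmf n \<epsilon> D =
     bind_pmf D (\<lambda>d. bind_pmf (slots_pmf n d) (\<lambda>S. erasure_pmf \<epsilon> S))"

text \<open>Non-erased copies of the neighbors \<open>0, \<dots>, m - 1\<close>, given that neighbor \<open>u\<close> has original
  degree \<open>l\<close>. Since the neighbors act independently, this conditioning only replaces the degree
  distribution of \<open>u\<close> by the point mass at \<open>l\<close>; this also makes sense if \<open>\<Lambda>\<close> gives \<open>l\<close> mass 0.\<close>

definition copies_pmf ::
  "nat \<Rightarrow> nat \<Rightarrow> real \<Rightarrow> nat pmf \<Rightarrow> nat \<Rightarrow> nat \<Rightarrow> (nat \<Rightarrow> nat set) pmf" where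
  "copies_pmf n m \<epsilon> \<Lambda> u l =
     Pi_pmf {..<m} {} (\<lambda>v. user_pmf n \<epsilon> (if v = u then return_pmf l else \<Lambda>))"

text \<open>The probability that neighbor \<open>u\<close> of original degree \<open>l\<close> is not resolved by a receiver of
  degree \<open>r\<close>; \<open>R\<close> is the set of slots in which the receiver itself transmits.\<close>

definition unresolved_prob ::
  "nat \<Rightarrow> nat \<Rightarrow> real \<Rightarrow> nat pmf \<Rightarrow> nat \<Rightarrow> nat \<Rightarrow> nat \<Rightarrow> real" where
  "unresolved_prob n m \<epsilon> \<Lambda> u l r =
     measure_pmf.prob (pair_pmf (slots_pmf n r) (copies_pmf n m \<epsilon> \<Lambda> u l))
       {(R, E). u \<in> unresolved ({..<n} - R) E {..<m}}"

end

theory Submission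
  imports Defs
begin

text \<open>Deleting slots can only enlarge the stopping set: the set left over by decoding with slots
  \<open>C\<close> is also stopped with respect to any \<open>C' \<subseteq> C\<close>. Hence, for fixed copies \<open>E\<close>, the receiver sets
  \<open>R\<close> leaving \<open>u\<close> unresolved form an up-closed family, and double counting the pairs \<open>(R, R \<union> {x})\<close>
  shows that the proportion of such sets among the \<open>d\<close>-subsets of \<open>{..<n}\<close> increases with \<open>d\<close>.\<close>

lemma unresolved_spec:
  assumes "finite V"
  shows "(sic_step C E)\<^sup>*\<^sup>* V (unresolved C E V)" and "sic_stopped C E (unresolved C E V)"
  using theI'[OF sic_unique_outcome[OF assms, of C E]] unfolding unresolved_def by blast+

text \<open>By \<open>sic_stopped_subset\<close>, every stopped subset of \<open>V\<close> survives
  any decoding run. Being stopped is a condition on each slot separately, so what is left under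
  \<open>C\<close> is stopped under \<open>C'\<close> and thus survives there too.\<close>

lemma unresolved_antimono:
  assumes "finite V" and "C' \<subseteq> C"
  shows "unresolved C E V \<subseteq> unresolved C' E V"
proof (rule sic_stopped_subset)
  show "(sic_step C' E)\<^sup>*\<^sup>* V (unresolved C' E V)"
    by (rule unresolved_spec[OF assms(1)])
  show "sic_stopped C' E (unresolved C E V)"
    using unresolved_spec(2)[OF assms(1), of C E] assms(2) by (auto simp: sic_stopped_def)
  show "unresolved C E V \<subseteq> V"
    by (rule sic_step_subset[OF unresolved_spec(1)[OF assms(1)]])
qed

text \<open>A local LYM inequality: a member of size \<open>d\<close> has \<open>card X - d\<close>
  one-point extensions, all in \<open>F\<close>, while a set of size \<open>Suc d\<close> arises
  from at most \<open>Suc d\<close> such extensions.\<close>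

lemma card_level_up_closed_le:
  fixes F :: "'a set set"
  assumes "finite X" and up: "\<And>A x. A \<in> F \<Longrightarrow> A \<subseteq> X \<Longrightarrow> x \<in> X \<Longrightarrow> insert x A \<in> F"
  shows "card {A \<in> F. A \<subseteq> X \<and> card A = d} * (card X - d)
    \<le> card {A \<in> F. A \<subseteq> X \<and> card A = Suc d} * Suc d"
proof -
  let ?L = "\<lambda>d. {A \<in> F. A \<subseteq> X \<and> card A = d}"
  have fin: "finite (?L k)" for k
    using assms(1) by (auto intro: finite_subset[of _ "Pow X"])
  have fin_sub: "finite A" if "A \<subseteq> X" for A
    using assms(1) that by (rule finite_subset[rotated])
  have "card (?L d) * (card X - d) = (\<Sum>A\<in>?L d. card (X - A))"
    using fin_sub by (simp add: card_Diff_subset)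
  also have "\<dots> = card (Sigma (?L d) (\<lambda>A. X - A))"
    using fin assms(1) by simp
  also have "\<dots> \<le> card (Sigma (?L (Suc d)) (\<lambda>B. B))"
  \<comment> \<open>Keeping the added point \<open>x\<close> as second component makes the map
    invertible: since \<open>x\<close> is not in \<open>A\<close>, deleting it recovers
    \<open>A\<close>.\<close>
  proof (rule card_inj_on_le)
    show "inj_on (\<lambda>(A, x). (insert x A, x)) (Sigma (?L d) (\<lambda>A. X - A))"
      by (rule inj_on_inverseI[where g = "\<lambda>(B, x). (B - {x}, x)"]) auto
    show "(\<lambda>(A, x). (insert x A, x)) ` Sigma (?L d) (\<lambda>A. X - A) \<subseteq> Sigma (?L (Suc d)) (\<lambda>B. B)"
      using up fin_sub by auto
    show "finite (Sigma (?L (Suc d)) (\<lambda>B. B))"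
      using fin fin_sub by auto
  qed
  also have "\<dots> = (\<Sum>B\<in>?L (Suc d). card B)"
    using fin fin_sub by simp
  also have "\<dots> = card (?L (Suc d)) * Suc d"
    by simp
  finally show ?thesis .
qed

lemma prob_slots_pmf:
  assumes "d \<le> n"
  shows "measure_pmf.prob (slots_pmf n d) F
    = card {A \<in> F. A \<subseteq> {..<n} \<and> card A = d} / (n choose d)"
proof -
  let ?S = "{A. A \<subseteq> {..<n} \<and> card A = d}"
  have card: "card ?S = n choose d"
    by (simp add: n_subsets)
  have "finite ?S"
    by (rule finite_subset[of _ "Pow {..<n}"]) auto
  \<comment> \<open>\<open>pmf_of_set\<close> is uniform only on a nonempty finite set;
    \<open>d \<le> n\<close> makes the binomial coefficient, hence the family, nonzero.\<close>
  moreover have "?S \<noteq> {}"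
    using card assms by (intro notI) (simp only: card.empty, simp)
  moreover have "?S \<inter> F = {A \<in> F. A \<subseteq> {..<n} \<and> card A = d}"
    by blast
  ultimately show ?thesis
    by (simp add: slots_pmf_def measure_pmf_of_set card)
qed

text \<open>The factors \<open>n - d\<close> and \<open>Suc d\<close> of the double count are
  exactly those relating the consecutive binomial coefficients, so normalizing the counts cancels
  them.\<close>

lemma prob_slots_pmf_Suc:
  assumes "Suc d \<le> n" and up: "\<And>A x. A \<in> F \<Longrightarrow> insert x A \<in> F"
  shows "measure_pmf.prob (slots_pmf n d) F \<le> measure_pmf.prob (slots_pmf n (Suc d)) F"
proof -
  let ?c = "\<lambda>d. card {A \<in> F. A \<subseteq> {..<n} \<and> card A = d}"
  have "?c d * (n - d) \<le> ?c (Suc d) * Suc d"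
    using card_level_up_closed_le[of "{..<n}" F d] up by simp
  then have *: "real (?c d) * (n - d) \<le> real (?c (Suc d)) * Suc d"
    by (simp only: of_nat_mult[symmetric] of_nat_le_iff)
  \<comment> \<open>Both sides equal \<open>n * ((n - 1) choose d)\<close>.\<close>
  have "Suc d * (n choose Suc d) = (n - d) * (n choose d)"
    using binomial_absorption[of d n] binomial_absorb_comp[of n d] by simp
  then have ch: "real (Suc d) * (n choose Suc d) = real (n - d) * (n choose d)"
    by (simp only: of_nat_mult[symmetric])
  have pos: "real (n choose d) > 0" "real (n choose Suc d) > 0" "real (n - d) > 0"
    using assms(1) by auto
  have "real (?c d) / (n choose d) = real (?c d) * (n - d) / (real (n - d) * (n choose d))"
    using pos by simp
  also have "\<dots> \<le> real (?c (Suc d)) * Suc d / (real (n - d) * (n choose d))"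
    using * by (rule divide_right_mono) simp
  also have "\<dots> = real (?c (Suc d)) / (n choose Suc d)"
    unfolding ch[symmetric] by (simp del: of_nat_Suc)
  finally show ?thesis
    using assms(1) by (simp add: prob_slots_pmf)
qed

lemma prob_slots_pmf_mono:
  assumes "d \<le> d'" and "d' \<le> n" and "\<And>A x. A \<in> F \<Longrightarrow> insert x A \<in> F"
  shows "measure_pmf.prob (slots_pmf n d) F \<le> measure_pmf.prob (slots_pmf n d') F"
  using assms(1,2)
proof (induction d' rule: dec_induct)
  case (step k)
  have "measure_pmf.prob (slots_pmf n d) F \<le> measure_pmf.prob (slots_pmf n k) F"
    using step by simp
  also have "\<dots> \<le> measure_pmf.prob (slots_pmf n (Suc k)) F"
    using step.prems assms(3) by (rule prob_slots_pmf_Suc)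
  finally show ?case .
qed simp

text \<open>By independence, the comparison can be made for each fixed second component and then
  averaged over \<open>k\<close>.\<close>

lemma prob_pair_pmf_mono:
  assumes "\<And>y. measure_pmf.prob p {x. (x, y) \<in> S} \<le> measure_pmf.prob p' {x. (x, y) \<in> S}"
  shows "measure_pmf.prob (pair_pmf p k) S \<le> measure_pmf.prob (pair_pmf p' k) S"
proof -
  have "emeasure (pair_pmf p k) S = (\<integral>\<^sup>+ y. emeasure p {x. (x, y) \<in> S} \<partial>k)" for p
  proof -
    \<comment> \<open>Exchanging the order of the two draws puts \<open>y\<close> outermost, as the
      integral over \<open>k\<close> requires.\<close>
    have "pair_pmf p k = bind_pmf k (\<lambda>y. map_pmf (\<lambda>x. (x, y)) p)"
      unfolding pair_pmf_def map_pmf_def by (rule bind_commute_pmf)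
    then show ?thesis
      by (simp add: emeasure_bind_pmf vimage_def)
  qed
  then have "emeasure (pair_pmf p k) S \<le> emeasure (pair_pmf p' k) S"
    using assms by (auto simp: measure_pmf.emeasure_eq_measure intro!: nn_integral_mono)
  then show ?thesis
    by (simp add: measure_pmf.emeasure_eq_measure)
qed

theorem lemma1:
  fixes q n m l r r' u :: nat and \<epsilon> :: real and \<Lambda> :: "nat pmf"
  assumes "q \<le> n" and "1 \<le> m"
    and "0 \<le> \<epsilon>" and "\<epsilon> \<le> 1"
    and "set_pmf \<Lambda> \<subseteq> {0..q}"
    and "l \<le> q" and "r \<le> q" and "r' \<le> q"
    and "u < m"
    and "r < r'"
  shows "unresolved_prob n m \<epsilon> \<Lambda> u l r \<le> unresolved_prob n m \<epsilon> \<Lambda> u l r'"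
  unfolding unresolved_prob_def
\<comment> \<open>The law of the copies is the same for both receiver degrees, so \<open>E\<close>
  is fixed and only the law of \<open>R\<close> changes.\<close>
proof (rule prob_pair_pmf_mono, rule prob_slots_pmf_mono)
  show "r \<le> r'" "r' \<le> n"
    using assms by auto
  fix E A x
  assume "A \<in> {R. (R, E) \<in> {(R, E). u \<in> unresolved ({..<n} - R) E {..<m}}}"
  moreover have "unresolved ({..<n} - A) E {..<m} \<subseteq> unresolved ({..<n} - insert x A) E {..<m}"
    by (rule unresolved_antimono) auto
  ultimately show "insert x A \<in> {R. (R, E) \<in> {(R, E). u \<in> unresolved ({..<n} - R) E {..<m}}}"
    by auto
qed

end
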